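(* Let $(X,\tau)$ be a topological space, $\delta$ a Lodato proximity on $X$ compatible with $\tau$, and $\mathscr{B}$ a non-empty subfamily of $\mathrm{CL}(X)$. Suppose that any point that does not belong to a closed set is strongly far from that closed set; that is, for every closed $F\subseteq X$ and every $x\in X\setminus F$, the sets $\{x\}$ and $F$ are $\delta$-strongly far. Then the hyperspace $(\mathrm{CL}(X),\tau_{\mathrm{sf},\mathscr{B}})$, where $\tau_{\mathrm{sf},\mathscr{B}}$ is the hit and strongly far miss topology associated with $\mathscr{B}$, is $T_2$ (Hausdorff) if and only if $\Sigma(\mathscr{B})$ is a strongly local family.
   Context: $\mathrm{CL}(X)$ is the set of all non-empty closed subsets of the topological space $X$. A Lodato proximity on a nonempty set $X$ is a relation $\delta$ on the power set $\mathscr{P}(X)$ such that for all $A,B,C\subseteq X$: (P0) $A\,\delta\,B \Rightarrow B\,\delta\,A$; (P1) $A\,\delta\,B \Rightarrow A\neq\emptyset$ and $B\neq\emptyset$; (P2) $A\cap B\neq\emptyset \Rightarrow A\,\delta\,B$; (P3) $A\,\delta\,(B\cup C) \Leftrightarrow A\,\delta\,B$ or $A\,\delta\,C$; (P4) if $A\,\delta\,B$ and $\{b\}\,\delta\,C$ for each $b\in B$, then $A\,\delta\,C$. (Separatedness of $\delta$ is not assumed.) Write $A\not\delta B$ for the negation of $A\,\delta\,B$. The proximity $\delta$ is compatible with $\tau$ if for every $A\subseteq X$ the $\tau$-closure of $A$ equals $\{x\in X:\{x\}\,\delta\,A\}$. Two subsets $A,B\subseteq X$ are $\delta$-strongly far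 if $A\not\delta B$ and there exists $C\subseteq X$ such that $A\not\delta (X\setminus C)$ and $C\not\delta B$. The topology $\tau_{\mathrm{sf},\mathscr{B}}$ on $\mathrm{CL}(X)$ is the one having as a subbase all sets of the following two forms: (i) $V^-=\{E\in \mathrm{CL}(X): E\cap V\neq\emptyset\}$, where $V$ is an open subset of $X$; (ii) $\{E\in\mathrm{CL}(X): E \text{ and } X\setminus A \text{ are } \delta\text{-strongly far}\}$, where $A$ is an open subset of $X$ with $X\setminus A\in\mathscr{B}$. $\Sigma(\mathscr{B})$ denotes the collection of all finite unions of elements of $\mathscr{B}$. A non-empty family $\mathscr{S}$ of subsets of $X$ is a strongly local family if for every $x\in X$ and every neighbourhood $U$ of $x$ there exists $S\in\mathscr{S}$ such that $x\in\operatorname{int}(S)$ and $S$ and $X\setminus U$ are $\delta$-strongly far. *)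

theory Defs
  imports "HOL-Analysis.Analysis"
begin

definition CL :: "'a topology \<Rightarrow> 'a set set" where
  "CL T = {E. closedin T E \<and> E \<noteq> {}}"

text \<open>A relation on the power set of the carrier \<open>X\<close> is rendered as a binary predicate on sets;
  its values outside \<open>Pow X\<close> are left unconstrained and are never used.\<close>

definition Lodato_proximity :: "'a set \<Rightarrow> ('a set \<Rightarrow> 'a set \<Rightarrow> bool) \<Rightarrow> bool" where
  "Lodato_proximity X \<delta> \<longleftrightarrow>
     X \<noteq> {} \<and>
     (\<forall>A B. A \<subseteq> X \<longrightarrow> B \<subseteq> X \<longrightarrow> \<delta> A B \<longrightarrow> \<delta> B A) \<and>
     (\<forall>A B. A \<subseteq> X \<longrightarrow> B \<subseteq> X \<longrightarrow> \<delta> A B \<longrightarrow> A \<noteq> {} \<and> B \<noteq> {}) \<and>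
     (\<forall>A B. A \<subseteq> X \<longrightarrow> B \<subseteq> X \<longrightarrow> A \<inter> B \<noteq> {} \<longrightarrow> \<delta> A B) \<and>
     (\<forall>A B C. A \<subseteq> X \<longrightarrow> B \<subseteq> X \<longrightarrow> C \<subseteq> X \<longrightarrow> (\<delta> A (B \<union> C) \<longleftrightarrow> \<delta> A B \<or> \<delta> A C)) \<and>
     (\<forall>A B C. A \<subseteq> X \<longrightarrow> B \<subseteq> X \<longrightarrow> C \<subseteq> X \<longrightarrow> \<delta> A B \<longrightarrow> (\<forall>b\<in>B. \<delta> {b} C) \<longrightarrow> \<delta> A C)"

definition compatible_proximity :: "'a topology \<Rightarrow> ('a set \<Rightarrow> 'a set \<Rightarrow> bool) \<Rightarrow> bool" where
  "compatible_proximity T \<delta> \<longleftrightarrow>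
     (\<forall>A. A \<subseteq> topspace T \<longrightarrow> T closure_of A = {x \<in> topspace T. \<delta> {x} A})"

definition strongly_far ::
    "'a set \<Rightarrow> ('a set \<Rightarrow> 'a set \<Rightarrow> bool) \<Rightarrow> 'a set \<Rightarrow> 'a set \<Rightarrow> bool" where
  "strongly_far X \<delta> A B \<longleftrightarrow> \<not> \<delta> A B \<and> (\<exists>C. C \<subseteq> X \<and> \<not> \<delta> A (X - C) \<and> \<not> \<delta> C B)"

definition sf_topology ::
    "'a topology \<Rightarrow> ('a set \<Rightarrow> 'a set \<Rightarrow> bool) \<Rightarrow> 'a set set \<Rightarrow> 'a set topology" where
  "sf_topology T \<delta> \<B> = topology_generated_by
     ({{E \<in> CL T. E \<inter> V \<noteq> {}} |V. openin T V} \<union>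
      {{E \<in> CL T. strongly_far (topspace T) \<delta> E (topspace T - A)} |A.
          openin T A \<and> topspace T - A \<in> \<B>})"

text \<open>The carrier of \<open>topology_generated_by\<close> is the union of the generating family. It is
  the whole hyperspace because the generator for the open set \<open>topspace T\<close> is all of \<open>CL T\<close>.\<close>

lemma topspace_sf_topology: "topspace (sf_topology T \<delta> \<B>) = CL T"
proof -
  have "CL T = {E \<in> CL T. E \<inter> topspace T \<noteq> {}}"
    by (auto simp: CL_def dest: closedin_subset)
  then show ?thesis
    unfolding sf_topology_def topology_generated_by_topspace by blast
qed

definition finite_unions :: "'a set set \<Rightarrow> 'a set set" where
  "finite_unions \<B> = {\<Union>\<F> |\<F>. finite \<F> \<and> \<F> \<subseteq> \<B>}"

text \<open>A neighbourhood of \<open>x\<close> is any set having \<open>x\<close> in its interior; it need not be open.\<close>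

definition strongly_local_family ::
    "'a topology \<Rightarrow> ('a set \<Rightarrow> 'a set \<Rightarrow> bool) \<Rightarrow> 'a set set \<Rightarrow> bool" where
  "strongly_local_family T \<delta> \<S> \<longleftrightarrow>
     \<S> \<noteq> {} \<and> \<S> \<subseteq> Pow (topspace T) \<and>
     (\<forall>x \<in> topspace T. \<forall>U. U \<subseteq> topspace T \<longrightarrow> x \<in> T interior_of U \<longrightarrow>
        (\<exists>S\<in>\<S>. x \<in> T interior_of S \<and> strongly_far (topspace T) \<delta> S (topspace T - U)))"

end

theory Submission
  imports Defs
begin

text \<open>Two closed sets \<open>E\<^sub>1 \<noteq> E\<^sub>2\<close> with \<open>x \<in> E\<^sub>1 - E\<^sub>2\<close> are separated by the interior of a member
  of \<open>\<Sigma>(\<B>)\<close> containing \<open>x\<close> and strongly far from \<open>E\<^sub>2\<close>: one set hits the interior, the other strongly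
  far misses its finitely many constituents.

  Conversely, given a closed \<open>E \<noteq> \<emptyset>\<close> and \<open>x \<notin> E\<close>, separate \<open>E \<union> cl {x}\<close> from \<open>E\<close> by disjoint open
  families \<open>M\<close> and \<open>N\<close>. The map \<open>y \<mapsto> E \<union> cl {y}\<close> is continuous, so it sends a neighbourhood of \<open>x\<close>
  into \<open>M\<close>. On the other hand, adding a point to \<open>E\<close> can only violate the miss conditions that
  define \<open>N\<close>, so it stays in \<open>N\<close> for all \<open>y\<close> outside some \<open>S \<in> \<Sigma>(\<B>)\<close> that is strongly far from
  \<open>E\<close>. Hence the neighbourhood is contained in \<open>S\<close>. The case \<open>E = \<emptyset>\<close> reduces to this one, unless
  \<open>cl {x}\<close> is the whole space; then the space is indiscrete.\<close>

lemma finite_unions_Un: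
  assumes "S \<in> finite_unions \<B>" "S' \<in> finite_unions \<B>"
  shows "S \<union> S' \<in> finite_unions \<B>"
proof -
  obtain \<F> where "finite \<F>" "\<F> \<subseteq> \<B>" "S = \<Union>\<F>"
    using assms(1) unfolding finite_unions_def by blast
  moreover obtain \<F>' where "finite \<F>'" "\<F>' \<subseteq> \<B>" "S' = \<Union>\<F>'"
    using assms(2) unfolding finite_unions_def by blast
  ultimately show ?thesis
    unfolding finite_unions_def by (intro CollectI exI[of _ "\<F> \<union> \<F>'"]) auto
qed

locale Lodato_space =
  fixes T :: "'a topology" and \<delta> :: "'a set \<Rightarrow> 'a set \<Rightarrow> bool"
  assumes proximity: "Lodato_proximity (topspace T) \<delta>"
    and compatible: "compatible_proximity T \<delta>"
begin

abbreviation sfar :: "'a set \<Rightarrow> 'a set \<Rightarrow> bool" where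
  "sfar \<equiv> strongly_far (topspace T) \<delta>"

text \<open>Singletons need not be closed here, so the closure of the point is adjoined; this keeps
  a closed \<open>E\<close> closed.\<close>

abbreviation add_point :: "'a set \<Rightarrow> 'a \<Rightarrow> 'a set" where
  "add_point E y \<equiv> E \<union> T closure_of {y}"

section \<open>Consequences of the proximity axioms and of compatibility\<close>

lemma near_sym: "\<delta> A B \<Longrightarrow> A \<subseteq> topspace T \<Longrightarrow> B \<subseteq> topspace T \<Longrightarrow> \<delta> B A"
  using proximity[unfolded Lodato_proximity_def, THEN conjunct2, THEN conjunct1]
  by blast

lemma not_near_empty: "A \<subseteq> topspace T \<Longrightarrow> \<not> \<delta> A {}"
  using proximity[unfolded Lodato_proximity_def, THEN conjunct2, THEN conjunct2, THEN conjunct1]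
  by blast

lemma near_if_meets: "A \<subseteq> topspace T \<Longrightarrow> B \<subseteq> topspace T \<Longrightarrow> A \<inter> B \<noteq> {} \<Longrightarrow> \<delta> A B"
  using proximity[unfolded Lodato_proximity_def, THEN conjunct2, THEN conjunct2, THEN conjunct2, THEN conjunct1]
  by simp

lemma near_Un:
  "A \<subseteq> topspace T \<Longrightarrow> B \<subseteq> topspace T \<Longrightarrow> C \<subseteq> topspace T \<Longrightarrow> \<delta> A (B \<union> C) \<longleftrightarrow> \<delta> A B \<or> \<delta> A C"
  using proximity[unfolded Lodato_proximity_def, THEN conjunct2, THEN conjunct2, THEN conjunct2, THEN conjunct2, THEN conjunct1]
  by simp

lemma near_trans:
  "\<delta> A B \<Longrightarrow> (\<And>b. b \<in> B \<Longrightarrow> \<delta> {b} C) \<Longrightarrow>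
    A \<subseteq> topspace T \<Longrightarrow> B \<subseteq> topspace T \<Longrightarrow> C \<subseteq> topspace T \<Longrightarrow> \<delta> A C"
  by (rule proximity[unfolded Lodato_proximity_def, THEN conjunct2, THEN conjunct2, THEN conjunct2, THEN conjunct2, THEN conjunct2, rule_format, of A B C])

lemma in_closure_iff_near:
  "A \<subseteq> topspace T \<Longrightarrow> x \<in> T closure_of A \<longleftrightarrow> x \<in> topspace T \<and> \<delta> {x} A"
  using compatible unfolding compatible_proximity_def by blast

lemma near_mono_right: "\<delta> A B \<Longrightarrow> B \<subseteq> C \<Longrightarrow> A \<subseteq> topspace T \<Longrightarrow> C \<subseteq> topspace T \<Longrightarrow> \<delta> A C"
  using near_Un[of A B C] by (simp add: Un_absorb1 subset_trans)

lemma near_mono_left: "\<delta> A B \<Longrightarrow> A \<subseteq> C \<Longrightarrow> B \<subseteq> topspace T \<Longrightarrow> C \<subseteq> topspace T \<Longrightarrow> \<delta> C B"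
  by (meson near_mono_right near_sym subset_trans)

text \<open>Compatibility makes every point of the closure near \<open>A\<close>, so axiom (P4)
  carries nearness of \<open>B\<close> from the closure to \<open>A\<close> itself.\<close>

lemma closure_near_imp_near:
  assumes "\<delta> (T closure_of A) B" "A \<subseteq> topspace T" "B \<subseteq> topspace T"
  shows "\<delta> A B"
proof -
  have "\<delta> B A"
    using near_trans[of B "T closure_of A" A] near_sym[OF assms(1)] assms(2,3)
    by (simp add: closure_of_subset_topspace in_closure_iff_near)
  then show ?thesis
    using near_sym assms(2,3) by blast
qed

lemma closure_singleton_subset:
  assumes "closedin T F" "z \<in> F"
  shows "T closure_of {z} \<subseteq> F"
  using assms by (simp add: closure_of_minimal)

lemma self_in_closure_singleton: "y \<in> topspace T \<Longrightarrow> y \<in> T closure_of {y}"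
  using closure_of_subset[of "{y}" T] by simp

text \<open>By compatibility both memberships say that \<open>{x}\<close> and \<open>{z}\<close> are
  near, and \<delta> is symmetric. This R0 property stands in for the T1 axiom, as \<delta> is not
  assumed separated.\<close>

lemma closure_singleton_sym:
  "z \<in> T closure_of {x} \<Longrightarrow> x \<in> topspace T \<Longrightarrow> x \<in> T closure_of {z}"
  using in_closure_iff_near near_sym by (metis bot_least insert_subset)

section \<open>Calculus of strongly far sets\<close>

lemma sfar_sym:
  assumes "sfar A B" "A \<subseteq> topspace T" "B \<subseteq> topspace T"
  shows "sfar B A"
proof -
  obtain C where C: "C \<subseteq> topspace T" "\<not> \<delta> A (topspace T - C)" "\<not> \<delta> C B" "\<not> \<delta> A B"
    using assms(1) unfolding strongly_far_def by blast
  \<comment> \<open>The complement of \<open>C\<close> is the intermediate set for the reversed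
    pair.\<close>
  have "topspace T - (topspace T - C) = C"
    using C(1) by blast
  then show ?thesis
    unfolding strongly_far_def
    by (metis C assms(2,3) near_sym Diff_subset)
qed

lemma sfar_mono_right:
  assumes "sfar A B" "B' \<subseteq> B" "A \<subseteq> topspace T" "B \<subseteq> topspace T"
  shows "sfar A B'"
  using assms near_mono_right unfolding strongly_far_def by meson

lemma sfar_mono_left:
  assumes "sfar A B" "A' \<subseteq> A" "A \<subseteq> topspace T" "B \<subseteq> topspace T"
  shows "sfar A' B"
  using assms near_mono_left unfolding strongly_far_def by (meson Diff_subset)

lemma sfar_empty: "A \<subseteq> topspace T \<Longrightarrow> sfar A {}"
  unfolding strongly_far_def using not_near_empty
  by (metis Diff_cancel order_refl)

lemma sfar_disjoint:
  "sfar A B \<Longrightarrow> A \<subseteq> topspace T \<Longrightarrow> B \<subseteq> topspace T \<Longrightarrow> A \<inter> B = {}"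
  using near_if_meets unfolding strongly_far_def by blast

text \<open>The intersection of the two intermediate sets works: it is far from both
  \<open>B1\<close> and \<open>B2\<close>, and its complement is the union of two sets far from
  \<open>A\<close>.\<close>

lemma sfar_Un:
  assumes "sfar A B1" "sfar A B2" "A \<subseteq> topspace T" "B1 \<subseteq> topspace T" "B2 \<subseteq> topspace T"
  shows "sfar A (B1 \<union> B2)"
proof -
  obtain C where C: "C \<subseteq> topspace T" "\<not> \<delta> A (topspace T - C)" "\<not> \<delta> C B1" "\<not> \<delta> A B1"
    using assms(1) unfolding strongly_far_def by blast
  obtain D where D: "D \<subseteq> topspace T" "\<not> \<delta> A (topspace T - D)" "\<not> \<delta> D B2" "\<not> \<delta> A B2"
    using assms(2) unfolding strongly_far_def by blast
  have "\<not> \<delta> (C \<inter> D) B1" "\<not> \<delta> (C \<inter> D) B2"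
    using C D assms(4,5) near_mono_left by (meson Int_lower1 Int_lower2)+
  then have "\<not> \<delta> (C \<inter> D) (B1 \<union> B2)"
    using C(1) assms(4,5) by (simp add: near_Un le_infI1)
  moreover have "\<not> \<delta> A (topspace T - (C \<inter> D))"
    using C D assms(3) by (simp add: Diff_Int near_Un)
  moreover have "\<not> \<delta> A (B1 \<union> B2)"
    using C D assms(3-5) by (simp add: near_Un)
  ultimately show ?thesis
    unfolding strongly_far_def using C(1) by blast
qed

text \<open>The same intermediate set serves, because a set far from \<open>A\<close> is far from
  the closure of \<open>A\<close>.\<close>

lemma sfar_closure:
  assumes "sfar A B" "A \<subseteq> topspace T" "B \<subseteq> topspace T"
  shows "sfar (T closure_of A) B"
  using assms closure_near_imp_near unfolding strongly_far_def by (meson Diff_subset)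

section \<open>Points and subbasic open sets of the hyperspace\<close>

lemma add_point_in_CL: "closedin T E \<Longrightarrow> y \<in> topspace T \<Longrightarrow> add_point E y \<in> CL T"
  using self_in_closure_singleton[of y] by (auto simp: CL_def)

lemma openin_hit:
  "openin T V \<Longrightarrow> openin (sf_topology T \<delta> \<B>) {E \<in> CL T. E \<inter> V \<noteq> {}}"
  unfolding sf_topology_def by (rule topology_generated_by_Basis) blast

lemma openin_sfar_miss:
  assumes "S \<in> \<B>" "\<B> \<subseteq> CL T"
  shows "openin (sf_topology T \<delta> \<B>) {E \<in> CL T. sfar E S}"
proof -
  have "closedin T S"
    using assms by (auto simp: CL_def)
  then have "openin T (topspace T - S)" "topspace T - (topspace T - S) = S"
    by (auto dest: closedin_subset)
  then show ?thesis
    unfolding sf_topology_def using assms(1)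
    by (intro topology_generated_by_Basis UnI2 CollectI exI[of _ "topspace T - S"]) auto
qed

lemma finite_unions_subset: "\<B> \<subseteq> CL T \<Longrightarrow> S \<in> finite_unions \<B> \<Longrightarrow> S \<subseteq> topspace T"
  unfolding finite_unions_def CL_def by (auto dest: closedin_subset)

section \<open>Strong locality implies the Hausdorff property\<close>

lemma separate_sf_topology:
  assumes "strongly_local_family T \<delta> (finite_unions \<B>)" "\<B> \<subseteq> CL T"
    and "E1 \<in> CL T" "E2 \<in> CL T" "x \<in> E1" "x \<notin> E2"
  shows "\<exists>M N. openin (sf_topology T \<delta> \<B>) M \<and> openin (sf_topology T \<delta> \<B>) N \<and>
           E1 \<in> M \<and> E2 \<in> N \<and> disjnt M N"
proof -
  have closed: "closedin T E1" "closedin T E2" and sub: "E1 \<subseteq> topspace T" "E2 \<subseteq> topspace T"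
    using assms(3,4) by (auto simp: CL_def dest: closedin_subset)
  then have x: "x \<in> topspace T" "x \<in> T interior_of (topspace T - E2)"
    using assms(5,6) by (auto simp: interior_of_openin openin_diff)
  obtain S where S: "S \<in> finite_unions \<B>" "x \<in> T interior_of S"
      "sfar S (topspace T - (topspace T - E2))"
    using assms(1) x unfolding strongly_local_family_def by (meson Diff_subset)
  have S_sub: "S \<subseteq> topspace T"
    using S(1) assms(2) by (rule finite_unions_subset[rotated])
  have "sfar E2 S"
    using S(3) S_sub sub(2) by (simp add: double_diff sfar_sym)
  obtain \<F> where \<F>: "finite \<F>" "\<F> \<subseteq> \<B>" "S = \<Union>\<F>"
    using S(1) unfolding finite_unions_def by blast
  \<comment> \<open>As \<open>x\<close> lies in the interior of \<open>S\<close>, the union is not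
    empty. So \<open>N\<close> below is an intersection over a nonempty finite family, as openness
    requires.\<close>
  have "\<F> \<noteq> {}"
    using S(2) \<F>(3) by auto
  define N where "N = (\<Inter>B\<in>\<F>. {E \<in> CL T. sfar E B})"
  have "openin (sf_topology T \<delta> \<B>) N"
    unfolding N_def using \<F> \<open>\<F> \<noteq> {}\<close> assms(2)
    by (intro openin_Inter) (auto intro: openin_sfar_miss)
  moreover have "openin (sf_topology T \<delta> \<B>) {E \<in> CL T. E \<inter> T interior_of S \<noteq> {}}"
    by (simp add: openin_hit)
  moreover have "E2 \<in> N"
    unfolding N_def using assms(4) \<open>sfar E2 S\<close> sub S_sub \<F>(3)
    by (auto intro!: sfar_mono_right[OF \<open>sfar E2 S\<close>])
  moreover have "{E \<in> CL T. E \<inter> T interior_of S \<noteq> {}} \<inter> N = {}"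
  proof -
    have "E \<inter> T interior_of S = {}" if "E \<in> N" "E \<in> CL T" for E
    proof -
      \<comment> \<open>Strongly far sets are disjoint, so missing each constituent forces
        \<open>E\<close> to miss \<open>S\<close>.\<close>
      have "E \<inter> B = {}" if "B \<in> \<F>" for B
        using \<open>E \<in> N\<close> \<open>E \<in> CL T\<close> that S_sub \<F>(3) unfolding N_def
        by (intro sfar_disjoint) (auto simp: CL_def dest: closedin_subset)
      then show ?thesis
        using \<F>(3) interior_of_subset[of T S] by blast
    qed
    then show ?thesis
      by blast
  qed
  ultimately show ?thesis
    using S(2) assms(3,5) unfolding disjnt_def by blast
qed

lemma Hausdorff_sf_topology:
  assumes "strongly_local_family T \<delta> (finite_unions \<B>)" "\<B> \<subseteq> CL T"
  shows "Hausdorff_space (sf_topology T \<delta> \<B>)"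
  unfolding Hausdorff_space_def topspace_sf_topology
proof (intro allI impI, elim conjE)
  fix E1 E2 assume E: "E1 \<in> CL T" "E2 \<in> CL T" "E1 \<noteq> E2"
  then consider x where "x \<in> E1" "x \<notin> E2" | x where "x \<in> E2" "x \<notin> E1"
    by blast
  then show "\<exists>M N. openin (sf_topology T \<delta> \<B>) M \<and> openin (sf_topology T \<delta> \<B>) N \<and>
      E1 \<in> M \<and> E2 \<in> N \<and> disjnt M N"
  proof cases
    case 1
    then show ?thesis
      using separate_sf_topology[OF assms E(1,2)] by simp
  next
    case 2
    then show ?thesis
      using separate_sf_topology[OF assms E(2,1)] disjnt_sym by metis
  qed
qed

end

section \<open>Adding a point to a closed set\<close>

locale point_sfar_space = Lodato_space +
  assumes point_sfar: "closedin T F \<Longrightarrow> x \<in> topspace T - F \<Longrightarrow> strongly_far (topspace T) \<delta> {x} F"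
begin

text \<open>The hypothesis on points enters here: \<open>{y}\<close> is strongly far from
  \<open>F\<close> as soon as \<open>y\<close> is outside \<open>F\<close>. This passes to the
  closure of \<open>{y}\<close>, and then to the union with \<open>E\<close>.\<close>

lemma sfar_add_point_iff:
  assumes "closedin T E" "closedin T F" "y \<in> topspace T"
  shows "sfar (add_point E y) F \<longleftrightarrow> sfar E F \<and> y \<notin> F"
proof -
  note sub = closedin_subset[OF assms(1)] closedin_subset[OF assms(2)]
    closure_of_subset_topspace[of T "{y}"]
  show ?thesis
  proof
    assume *: "sfar (add_point E y) F"
    then have "sfar E F"
      using sub by (auto intro: sfar_mono_left)
    moreover have "add_point E y \<inter> F = {}"
      using * sub by (intro sfar_disjoint) auto
    ultimately show "sfar E F \<and> y \<notin> F"
      using self_in_closure_singleton[OF assms(3)] by blast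
  next
    assume *: "sfar E F \<and> y \<notin> F"
    then have "sfar (T closure_of {y}) F"
      using assms(2,3) sub point_sfar by (intro sfar_closure) auto
    then show "sfar (add_point E y) F"
      using * sub by (meson sfar_Un sfar_sym Un_least)
  qed
qed

text \<open>Subbasic preimages suffice. A hit set pulls back to \<open>V\<close>, or to the whole
  space if \<open>E\<close> already meets \<open>V\<close>; a miss set pulls back to
  \<open>A\<close>, or to the empty set if \<open>E\<close> itself violates the condition.\<close>

lemma continuous_map_add_point:
  assumes "closedin T E"
  shows "continuous_map T (sf_topology T \<delta> \<B>) (add_point E)"
  unfolding sf_topology_def
proof (rule continuous_on_generated_topo)
  fix U
  assume "U \<in> {{E \<in> CL T. E \<inter> V \<noteq> {}} |V. openin T V} \<union>
      {{E \<in> CL T. sfar E (topspace T - A)} |A. openin T A \<and> topspace T - A \<in> \<B>}"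
  then consider V where "openin T V" "U = {E \<in> CL T. E \<inter> V \<noteq> {}}"
    | A where "openin T A" "U = {E \<in> CL T. sfar E (topspace T - A)}"
    by blast
  then show "openin T (add_point E -` U \<inter> topspace T)"
  proof cases
    case 1
    have "T closure_of {y} \<inter> V \<noteq> {} \<longleftrightarrow> y \<in> V" if "y \<in> topspace T" for y
      using openin_Int_closure_of_eq_empty[OF 1(1), of "{y}"] by auto
    then have "add_point E -` U \<inter> topspace T = (if E \<inter> V = {} then V else topspace T)"
      using 1 openin_subset[OF 1(1)] add_point_in_CL[OF assms] by (auto simp: Int_Un_distrib2)
    then show ?thesis
      using 1(1) by simp
  next
    case 2
    have "closedin T (topspace T - A)"
      using 2(1) by (simp add: closedin_diff)
    have "add_point E -` U \<inter> topspace T = (if sfar E (topspace T - A) then A else {})"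
      using 2 openin_subset[OF 2(1)] add_point_in_CL[OF assms]
        sfar_add_point_iff[OF assms \<open>closedin T (topspace T - A)\<close>] by auto
    then show ?thesis
      using 2(1) by simp
  qed
next
  show "add_point E ` topspace T \<subseteq> \<Union> ({{E \<in> CL T. E \<inter> V \<noteq> {}} |V. openin T V} \<union>
      {{E \<in> CL T. sfar E (topspace T - A)} |A. openin T A \<and> topspace T - A \<in> \<B>})"
    unfolding topspace_sf_topology[unfolded sf_topology_def topology_generated_by_topspace]
    using add_point_in_CL[OF assms] by blast
qed

text \<open>Induction on the generation of \<open>N\<close>. Hit sets survive enlarging
  \<open>E\<close>, so they exclude no points; a miss set excludes only the points of its own member
  of \<open>\<B>\<close>. Binary intersections take the union of the two exceptional sets.\<close>

lemma add_point_stays_in_open: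
  assumes "closedin T E" "\<B> \<subseteq> CL T" "openin (sf_topology T \<delta> \<B>) N" "E \<in> N"
  shows "\<exists>S\<in>finite_unions \<B>. sfar E S \<and> (\<forall>y\<in>topspace T - S. add_point E y \<in> N)"
proof -
  note E_sub = closedin_subset[OF assms(1)]
  let ?G = "{{E \<in> CL T. E \<inter> V \<noteq> {}} |V. openin T V} \<union>
      {{E \<in> CL T. sfar E (topspace T - A)} |A. openin T A \<and> topspace T - A \<in> \<B>}"
  have "generate_topology_on ?G N"
    using assms(3) unfolding sf_topology_def openin_topology_generated_by_iff .
  then show ?thesis
    using assms(4)
  proof induction
    case Empty
    then show ?case by simp
  next
    case (Int M N)
    then obtain S S' where S: "S \<in> finite_unions \<B>" "sfar E S"
        "\<forall>y\<in>topspace T - S. add_point E y \<in> M"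
      and S': "S' \<in> finite_unions \<B>" "sfar E S'" "\<forall>y\<in>topspace T - S'. add_point E y \<in> N"
      by blast
    have "S \<union> S' \<in> finite_unions \<B>"
      using S(1) S'(1) by (rule finite_unions_Un)
    moreover have "sfar E (S \<union> S')"
      using S S' E_sub assms(2) by (intro sfar_Un) (auto dest: finite_unions_subset)
    ultimately show ?case
      using S(3) S'(3) by blast
  next
    case (UN K)
    then show ?case
      by (meson UnionE UnionI)
  next
    case (Basis M)
    then consider V where "M = {E \<in> CL T. E \<inter> V \<noteq> {}}"
      | A where "openin T A" "topspace T - A \<in> \<B>" "M = {E \<in> CL T. sfar E (topspace T - A)}"
      by blast
    then show ?case
    proof cases
      case 1
      then have "\<forall>y\<in>topspace T - {}. add_point E y \<in> M"
        using Basis(2) add_point_in_CL[OF assms(1)] by blast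
      moreover have "{} \<in> finite_unions \<B>"
        unfolding finite_unions_def by blast
      ultimately show ?thesis
        using sfar_empty[OF E_sub] by blast
    next
      case 2
      have "topspace T - A \<in> finite_unions \<B>"
        unfolding finite_unions_def using 2(2)
        by (intro CollectI exI[of _ "{topspace T - A}"]) auto
      moreover have "sfar E (topspace T - A)"
        using Basis(2) 2(3) by blast
      moreover have "closedin T (topspace T - A)"
        using 2(1) by (simp add: closedin_diff)
      moreover have "\<forall>y\<in>topspace T - (topspace T - A). add_point E y \<in> M"
        using 2 \<open>sfar E (topspace T - A)\<close> add_point_in_CL[OF assms(1)]
          sfar_add_point_iff[OF assms(1) \<open>closedin T (topspace T - A)\<close>] by auto
      ultimately show ?thesis
        by blast
    qed
  qed
qed

section \<open>The Hausdorff property implies strong locality\<close>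

lemma Hausdorff_imp_sfar_neighbourhood:
  assumes "Hausdorff_space (sf_topology T \<delta> \<B>)" "\<B> \<subseteq> CL T"
    and "E \<in> CL T" "x \<in> topspace T - E"
  shows "\<exists>S\<in>finite_unions \<B>. x \<in> T interior_of S \<and> sfar S E"
proof -
  have closed: "closedin T E" and sub: "E \<subseteq> topspace T"
    using assms(3) by (auto simp: CL_def dest: closedin_subset)
  have "add_point E x \<noteq> E" "add_point E x \<in> CL T"
    using assms(4) closed self_in_closure_singleton[of x] add_point_in_CL[of E x] by auto
  then obtain M N where MN: "openin (sf_topology T \<delta> \<B>) M" "openin (sf_topology T \<delta> \<B>) N"
      "add_point E x \<in> M" "E \<in> N" "disjnt M N"
    using assms(1,3) unfolding Hausdorff_space_def topspace_sf_topology by metis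
  obtain S where S: "S \<in> finite_unions \<B>" "sfar E S"
      "\<forall>y\<in>topspace T - S. add_point E y \<in> N"
    using add_point_stays_in_open[OF closed assms(2) MN(2,4)] by blast
  define W where "W = {y \<in> topspace T. add_point E y \<in> M}"
  have "openin T W"
    unfolding W_def
    by (rule openin_continuous_map_preimage[OF continuous_map_add_point[OF closed] MN(1)])
  \<comment> \<open>A point of \<open>W\<close> outside \<open>S\<close> would put
    \<open>add_point E y\<close> into both \<open>M\<close> and \<open>N\<close>, which are
    disjoint.\<close>
  moreover have "W \<subseteq> S" "x \<in> W"
    using S(3) MN(3,5) assms(4) unfolding W_def disjnt_def by blast+
  ultimately have "x \<in> T interior_of S"
    by (meson interior_of_maximal subsetD)
  then show ?thesis
    using S(1,2) sub finite_unions_subset[OF assms(2) S(1)] sfar_sym by blast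
qed

text \<open>Any \<open>z\<close> in \<open>F\<close> lies in the closure of \<open>{x}\<close>. By
  symmetry \<open>x\<close> lies in the closure of \<open>{z}\<close>, hence in \<open>F\<close>,
  and then so does the whole closure of \<open>{x}\<close>.\<close>

lemma indiscrete_if_dense_point:
  assumes "T closure_of {x} = topspace T" "x \<in> topspace T" "F \<in> CL T"
  shows "F = topspace T"
proof -
  have F: "closedin T F" "F \<noteq> {}"
    using assms(3) by (auto simp: CL_def)
  then obtain z where "z \<in> F" "z \<in> topspace T"
    using closedin_subset by blast
  then have "x \<in> F"
    using assms closure_singleton_sym[of z x] closure_singleton_subset[OF F(1)] by blast
  then show ?thesis
    using assms(1) closure_singleton_subset[OF F(1)] closedin_subset[OF F(1)] by blast
qed

lemma strongly_local_if_Hausdorff: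
  assumes "Hausdorff_space (sf_topology T \<delta> \<B>)" "\<B> \<subseteq> CL T" "\<B> \<noteq> {}"
  shows "strongly_local_family T \<delta> (finite_unions \<B>)"
  unfolding strongly_local_family_def
proof (intro conjI ballI allI impI)
  show "finite_unions \<B> \<noteq> {}"
    unfolding finite_unions_def by blast
  show "finite_unions \<B> \<subseteq> Pow (topspace T)"
    using finite_unions_subset[OF assms(2)] by blast
  fix x U assume x: "x \<in> topspace T" and U: "U \<subseteq> topspace T" "x \<in> T interior_of U"
  \<comment> \<open>\<open>U\<close> need not be open, so its complement is enlarged to a closed set
    still avoiding \<open>x\<close>; being strongly far from the larger set is enough.\<close>
  define E where "E = topspace T - T interior_of U"
  have E: "closedin T E" "x \<notin> E" "topspace T - U \<subseteq> E" "E \<subseteq> topspace T"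
    unfolding E_def using U interior_of_subset[of T U] by auto
  have "\<exists>S\<in>finite_unions \<B>. x \<in> T interior_of S \<and> sfar S E"
  proof (cases "E = {}")
    case False
    then show ?thesis
      using Hausdorff_imp_sfar_neighbourhood[OF assms(1,2)] E x by (auto simp: CL_def)
  next
    case True
    \<comment> \<open>Every subset is strongly far from the empty set, so only the interior
      condition remains.\<close>
    have "\<exists>S\<in>finite_unions \<B>. x \<in> T interior_of S"
    proof (cases "T closure_of {x} = topspace T")
      case True
      \<comment> \<open>The whole space is the only nonempty closed set, and \<open>\<B>\<close> is
        nonempty.\<close>
      then have "\<B> = {topspace T}"
        using indiscrete_if_dense_point[OF _ x] assms(2,3) by blast
      then have "topspace T \<in> finite_unions \<B>"
        unfolding finite_unions_def by (intro CollectI exI[of _ "{topspace T}"]) auto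
      then show ?thesis
        using x by (metis interior_of_topspace)
    next
      case False
      then obtain y where y: "y \<in> topspace T" "y \<notin> T closure_of {x}"
        using closure_of_subset_topspace[of T "{x}"] by blast
      \<comment> \<open>The closure of \<open>{y}\<close> is a nonempty closed set avoiding
        \<open>x\<close>, so it can replace the empty \<open>E\<close> in the neighbourhood
        lemma.\<close>
      then have "x \<notin> T closure_of {y}" "T closure_of {y} \<in> CL T"
        using closure_singleton_sym[of x y] self_in_closure_singleton[of y] by (auto simp: CL_def)
      then show ?thesis
        using Hausdorff_imp_sfar_neighbourhood[OF assms(1,2)] x by blast
    qed
    then show ?thesis
      using True sfar_empty finite_unions_subset[OF assms(2)] by blast
  qed
  then show "\<exists>S\<in>finite_unions \<B>. x \<in> T interior_of S \<and> sfar S (topspace T - U)"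
    using E sfar_mono_right finite_unions_subset[OF assms(2)] by meson
qed

end

theorem theorem4p4:
  fixes T :: "'a topology"
    and \<delta> :: "'a set \<Rightarrow> 'a set \<Rightarrow> bool"
    and \<B> :: "'a set set"
  assumes "Lodato_proximity (topspace T) \<delta>"
    and "compatible_proximity T \<delta>"
    and "\<B> \<noteq> {}"
    and "\<B> \<subseteq> CL T"
    and "\<And>F x. closedin T F \<Longrightarrow> x \<in> topspace T - F \<Longrightarrow> strongly_far (topspace T) \<delta> {x} F"
  shows "Hausdorff_space (sf_topology T \<delta> \<B>) \<longleftrightarrow>
         strongly_local_family T \<delta> (finite_unions \<B>)"
proof -
  interpret point_sfar_space T \<delta>
    using assms(1,2,5) by unfold_locales
  show ?thesis
    using strongly_local_if_Hausdorff Hausdorff_sf_topology assms(3,4) by blast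
qed

end
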